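(* Let $0<T_1<T<\infty$, $0<\delta<1$ and $\lambda,\Lambda>0$. There exist constants $\epsilon,\mu>0$, depending only on $n,\lambda,\Lambda,\delta,T_1,T$, such that the following holds. Let $a_{ij},b_i,c\in L^\infty(B_1\times(0,T])$ satisfy $$|a_{ij}(x,t)|+|b_i(x,t)|+|c(x,t)|\le\Lambda,\qquad a_{ij}(x,t)\xi_i\xi_j\ge\lambda|\xi|^2\qquad\text{for all }x\in B_1,\ 0<t\le T,\ \xi\in\mathbb{R}^n,$$ and set $Lu:=a_{ij}(x,t)\partial_{ij}u+b_i(x,t)\partial_iu+c(x,t)u$. If $u\in LSC(\overline{B_1}\times[0,T])$ satisfies $$(L-\partial_t)u\le\epsilon\quad\text{in }B_1\times(0,T]\text{ in the viscosity sense},$$ $$u(x,0)\ge1\quad\text{for }|x|\le\delta,$$ $$u\ge0\quad\text{on }P\partial(B_1\times(0,T]),$$ then $$u(x,t)\ge\mu(1-|x|)\quad\text{on }B_1\times[T_1,T].$$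
   Context: $B_1$ is the open unit ball in $\mathbb{R}^n$ centered at the origin; $LSC$ denotes lower-semicontinuous functions; repeated indices are summed; $\partial_i,\partial_{ij}$ are derivatives in $x$. The parabolic boundary is $P\partial(B_1\times(0,T])=(\overline{B_1}\times\{0\})\cup(\partial B_1\times[0,T])$. The coefficients are bounded measurable functions defined at every point. Viscosity sense: whenever $(x_0,t_0)\in B_1\times(0,T]$ and $\varphi$ is a $C^2$ function near $(x_0,t_0)$ with $\varphi\le u$ at the points of $B_1\times(0,T]$ near $(x_0,t_0)$ and $\varphi(x_0,t_0)=u(x_0,t_0)$, one has $(L\varphi-\varphi_t)(x_0,t_0)\le\epsilon$. *)

theory Defs
  imports "HOL-Analysis.Analysis"
begin

(* Points (x,t) of space-time are pairs p :: (real ^ 'n) * real.  Functions are total;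
   only their values on the cylinders below are ever used. *)

definition par_cylinder :: "real \<Rightarrow> ((real ^ 'n) \<times> real) set" where
  "par_cylinder T = ball 0 1 \<times> {0<..T}"

definition par_boundary :: "real \<Rightarrow> ((real ^ 'n) \<times> real) set" where
  "par_boundary T = (cball 0 1 \<times> {0}) \<union> (sphere 0 1 \<times> {0..T})"

definition lsc_on :: "'a::topological_space set \<Rightarrow> ('a \<Rightarrow> real) \<Rightarrow> bool" where
  "lsc_on S f \<longleftrightarrow> (\<forall>x\<in>S. \<forall>y<f x. \<forall>\<^sub>F z in at x within S. y < f z)"

definition dir_deriv :: "'a::real_normed_vector \<Rightarrow> ('a \<Rightarrow> real) \<Rightarrow> 'a \<Rightarrow> real" where
  "dir_deriv v f p = frechet_derivative f (at p) v"

(* In finite dimension, continuity of all directional derivatives is continuity of the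
   derivative.  C1_on and C2_on are only used for open S. *)
definition C1_on :: "'a::euclidean_space set \<Rightarrow> ('a \<Rightarrow> real) \<Rightarrow> bool" where
  "C1_on S f \<longleftrightarrow> (\<forall>p\<in>S. f differentiable (at p)) \<and> (\<forall>v. continuous_on S (dir_deriv v f))"

definition C2_on :: "'a::euclidean_space set \<Rightarrow> ('a \<Rightarrow> real) \<Rightarrow> bool" where
  "C2_on S f \<longleftrightarrow> C1_on S f \<and> (\<forall>v. C1_on S (dir_deriv v f))"

definition dx :: "'n::finite \<Rightarrow> ((real ^ 'n) \<times> real \<Rightarrow> real) \<Rightarrow> (real ^ 'n) \<times> real \<Rightarrow> real" where
  "dx i = dir_deriv (axis i 1, 0)"

definition dt :: "((real ^ 'n::finite) \<times> real \<Rightarrow> real) \<Rightarrow> (real ^ 'n) \<times> real \<Rightarrow> real" where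
  "dt = dir_deriv (0, 1)"

definition lin_op ::
  "('n::finite \<Rightarrow> 'n \<Rightarrow> (real ^ 'n) \<times> real \<Rightarrow> real) \<Rightarrow> ('n \<Rightarrow> (real ^ 'n) \<times> real \<Rightarrow> real) \<Rightarrow>
   ((real ^ 'n) \<times> real \<Rightarrow> real) \<Rightarrow>
   ((real ^ 'n) \<times> real \<Rightarrow> real) \<Rightarrow> (real ^ 'n) \<times> real \<Rightarrow> real" where
  "lin_op a b c f p =
     (\<Sum>i\<in>UNIV. \<Sum>j\<in>UNIV. a i j p * dx i (dx j f) p) + (\<Sum>i\<in>UNIV. b i p * dx i f p) + c p * f p"

(* (L - d/dt) u <= e in the viscosity sense.  The test function is C2 on a full space-time
   neighbourhood N of p, also when p lies at the final time T, but it has to stay below u only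
   at the points of N in the cylinder. *)
definition viscosity_supersol ::
  "('n::finite \<Rightarrow> 'n \<Rightarrow> (real ^ 'n) \<times> real \<Rightarrow> real) \<Rightarrow> ('n \<Rightarrow> (real ^ 'n) \<times> real \<Rightarrow> real) \<Rightarrow>
   ((real ^ 'n) \<times> real \<Rightarrow> real) \<Rightarrow> real \<Rightarrow> real \<Rightarrow>
   ((real ^ 'n) \<times> real \<Rightarrow> real) \<Rightarrow> bool" where
  "viscosity_supersol a b c e T u \<longleftrightarrow>
     (\<forall>p \<in> par_cylinder T. \<forall>N \<phi>.
        open N \<and> p \<in> N \<and> C2_on N \<phi> \<and> (\<forall>q \<in> N \<inter> par_cylinder T. \<phi> q \<le> u q) \<and> \<phi> p = u p
        \<longrightarrow> lin_op a b c \<phi> p - dt \<phi> p \<le> e)"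

end

theory Submission
  imports Defs
begin

text \<open>
  Positivity near the centre of the initial disc spreads to the whole ball in an arbitrarily short
  time, and it is bounded below linearly at the lateral boundary as in the Hopf lemma. Since the
  coefficients are merely bounded, the proof is by comparison with an explicit smooth barrier.

  Fix a target time \<open>s\<close> in \<open>[T1, T]\<close> and put \<open>w = \<rho>(t) - |x|\<^sup>2\<close>, where \<open>\<rho>\<close> rises from \<open>\<delta>\<^sup>2\<close> at
  time \<open>0\<close> to its maximum \<open>1\<close> at time \<open>s\<close>. The function
  \<open>P = exp (-\<alpha> - \<beta> t) (exp (\<alpha> w) - 1)\<close> is positive exactly in the moving paraboloid \<open>w > 0\<close>, and it
  is a subsolution there: away from the axis the term \<open>\<alpha>\<^sup>2 a x x\<close> wins if \<open>\<alpha>\<close> is large, and near the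
  axis, where \<open>w\<close> is bounded below, the decay \<open>exp (-\<beta> t)\<close> wins if \<open>\<beta>\<close> is large. Outside the
  paraboloid \<open>P\<close> is replaced by \<open>0\<close>, which is harmless because a maximum of subsolutions is a
  subsolution.

  The equation for \<open>u\<close> only holds up to an error \<open>\<epsilon>\<close>. It is absorbed by the corrector
  \<open>N = \<eta> exp (\<beta> t) (exp (-\<alpha> (1 - |x|\<^sup>2)) - 1)\<close>, which is nonpositive, vanishes for \<open>|x| = 1\<close> and is a
  subsolution with a uniformly positive right-hand side, for the same two reasons, the growth of \<open>exp (\<beta> t)\<close>
  now acting on a negative function. So
  \<open>max P 0 + N\<close> is a strict subsolution that lies below \<open>u\<close> on the parabolic boundary
  (\<open>ramp_with_peak\<close>, \<open>barrier_exponents\<close>), and comparison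
  (\<open>supersolution_ge_strict_subsolution\<close>) gives \<open>u \<ge> max P 0 + N\<close>. At time \<open>s\<close>, where \<open>\<rho> = 1\<close>,
  both \<open>P\<close> and \<open>-N\<close> are comparable with \<open>1 - |x|\<^sup>2\<close>; for small \<open>\<eta>\<close> at least half of the lower bound for \<open>P\<close> survives. All constants
  are independent of \<open>s\<close> because \<open>\<rho>'\<close> is bounded above by \<open>exp 1 / T1\<close>.
\<close>

section \<open>Smooth functions and the operator\<close>

lemma dir_deriv_eq:
  assumes "(f has_derivative D) (at p)"
  shows "dir_deriv v f p = D v"
  using frechet_derivative_at[OF assms] by (simp add: dir_deriv_def)

lemma C1_on_UNIV_intro:
  assumes "\<And>p. (f has_derivative D p) (at p)"
    and "\<And>v. continuous_on UNIV (\<lambda>p. D p v)"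
  shows "C1_on UNIV f"
proof -
  have "dir_deriv v f = (\<lambda>p. D p v)" for v
    using dir_deriv_eq[OF assms(1)] by blast
  then show ?thesis
    using assms by (auto simp: C1_on_def differentiable_def)
qed

lemma C2_on_UNIV_intro:
  assumes "\<And>p. (f has_derivative D p) (at p)"
    and "\<And>v. C1_on UNIV (\<lambda>p. D p v)"
  shows "C2_on UNIV f"
proof -
  have D: "dir_deriv v f = (\<lambda>p. D p v)" for v
    using dir_deriv_eq[OF assms(1)] by blast
  have "continuous_on UNIV (\<lambda>p. D p v)" for v
    using assms(2)[of v]
    by (auto simp: C1_on_def differentiable_imp_continuous_within
        intro!: continuous_at_imp_continuous_on)
  then have "C1_on UNIV f"
    by (intro C1_on_UNIV_intro[OF assms(1)])
  then show ?thesis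
    using assms(2) by (simp add: C2_on_def D)
qed

lemma C1_on_has_derivative:
  assumes "C1_on UNIV f"
  shows "(f has_derivative (\<lambda>v. dir_deriv v f p)) (at p)"
  using assms by (simp add: C1_on_def dir_deriv_def frechet_derivative_works)

lemma C1_on_continuous:
  assumes "C1_on UNIV f"
  shows "continuous_on UNIV f"
  using assms by (auto simp: C1_on_def differentiable_imp_continuous_within
        intro!: continuous_at_imp_continuous_on)

lemma C1_on_add:
  assumes "C1_on UNIV f" "C1_on UNIV g"
  shows "C1_on UNIV (\<lambda>p. f p + g p)"
  by (rule C1_on_UNIV_intro[where D = "\<lambda>p v. dir_deriv v f p + dir_deriv v g p"])
    (use assms in \<open>auto simp: C1_on_def intro!: derivative_intros continuous_intros
       C1_on_has_derivative[OF assms(1)] C1_on_has_derivative[OF assms(2)]\<close>)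

lemma C1_on_mult:
  assumes "C1_on UNIV f" "C1_on UNIV g"
  shows "C1_on UNIV (\<lambda>p. f p * g p)"
proof (rule C1_on_UNIV_intro)
  show "((\<lambda>p. f p * g p) has_derivative
          (\<lambda>v. f p * dir_deriv v g p + dir_deriv v f p * g p)) (at p)" for p
    by (intro has_derivative_mult C1_on_has_derivative assms)
  show "continuous_on UNIV (\<lambda>p. f p * dir_deriv v g p + dir_deriv v f p * g p)" for v
    using assms C1_on_continuous[OF assms(1)] C1_on_continuous[OF assms(2)]
    by (auto simp: C1_on_def intro!: continuous_intros)
qed

lemma C1_on_const: "C1_on UNIV (\<lambda>p. k)"
  by (rule C1_on_UNIV_intro[where D = "\<lambda>p v. 0"]) auto

lemma C2_on_imp_C1_on: "C2_on S f \<Longrightarrow> C1_on S f"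
  by (simp add: C2_on_def)

lemma C2_on_dir_deriv: "C2_on S f \<Longrightarrow> C1_on S (dir_deriv v f)"
  by (simp add: C2_on_def)

lemma dir_deriv_add:
  assumes "C1_on UNIV f" "C1_on UNIV g"
  shows "dir_deriv v (\<lambda>p. f p + g p) = (\<lambda>p. dir_deriv v f p + dir_deriv v g p)"
  by (rule ext, rule dir_deriv_eq)
    (intro has_derivative_add C1_on_has_derivative assms)

lemma dir_deriv_cmult:
  assumes "C1_on UNIV f"
  shows "dir_deriv v (\<lambda>p. k * f p) = (\<lambda>p. k * dir_deriv v f p)"
  by (rule ext, rule dir_deriv_eq)
    (intro has_derivative_mult_right C1_on_has_derivative assms)

lemma C2_on_add:
  assumes "C2_on UNIV f" "C2_on UNIV g"
  shows "C2_on UNIV (\<lambda>p. f p + g p)"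
  using assms unfolding C2_on_def by (auto simp: dir_deriv_add intro!: C1_on_add)

lemma C2_on_cmult:
  assumes "C2_on UNIV f"
  shows "C2_on UNIV (\<lambda>p. k * f p)"
  using assms unfolding C2_on_def
  by (auto simp: dir_deriv_cmult intro!: C1_on_mult C1_on_const)

definition parabolic_op where
  "parabolic_op a b c f p = lin_op a b c f p - dt f p"

lemma parabolic_op_add:
  assumes "C2_on UNIV f" "C2_on UNIV g"
  shows "parabolic_op a b c (\<lambda>p. f p + g p) p = parabolic_op a b c f p + parabolic_op a b c g p"
proof -
  note [simp] = dir_deriv_add C2_on_imp_C1_on[OF assms(1)] C2_on_imp_C1_on[OF assms(2)]
    C2_on_dir_deriv[OF assms(1)] C2_on_dir_deriv[OF assms(2)]
  show ?thesis
    by (simp add: parabolic_op_def lin_op_def dx_def dt_def algebra_simps sum.distrib)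
qed

lemma parabolic_op_cmult:
  assumes "C2_on UNIV f"
  shows "parabolic_op a b c (\<lambda>p. k * f p) p = k * parabolic_op a b c f p"
proof -
  note [simp] = dir_deriv_cmult C2_on_imp_C1_on[OF assms(1)] C2_on_dir_deriv[OF assms(1)]
  show ?thesis
    by (simp add: parabolic_op_def lin_op_def dx_def dt_def algebra_simps sum_distrib_left)
qed

section \<open>Exponentials of radial quadratics\<close>

text \<open>Both the barrier and the factor that absorbs the zeroth-order coefficient are linear
  combinations of these functions, and the operator acts on each of them as multiplication by an
  explicit factor.\<close>
definition exp_quad :: "real \<Rightarrow> (real \<Rightarrow> real) \<Rightarrow> ('a::real_inner) \<times> real \<Rightarrow> real" where
  "exp_quad \<gamma> g p = exp (g (snd p) + \<gamma> * (fst p \<bullet> fst p))"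

lemma has_derivative_comp_snd:
  fixes p :: "'a::real_normed_vector \<times> real"
  assumes "\<And>t. (g has_real_derivative g' t) (at t)"
  shows "((\<lambda>q. g (snd q)) has_derivative (\<lambda>v. g' (snd p) * snd v)) (at p)"
  by (rule has_derivative_compose[OF has_derivative_snd[OF has_derivative_ident]
        assms[unfolded has_field_derivative_def]])

lemma exp_quad_has_derivative:
  assumes "\<And>t. (g has_real_derivative g' t) (at t)"
  shows "(exp_quad \<gamma> g has_derivative
     (\<lambda>v. (g' (snd p) * snd v + 2 * \<gamma> * (fst p \<bullet> fst v)) * exp_quad \<gamma> g p)) (at p)"
proof -
  note g = has_derivative_comp_snd[OF assms, of p]
  have "((\<lambda>q. exp (g (snd q) + \<gamma> * (fst q \<bullet> fst q))) has_derivative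
     (\<lambda>v. (g' (snd p) * snd v + 2 * \<gamma> * (fst p \<bullet> fst v)) * exp_quad \<gamma> g p)) (at p)"
    unfolding exp_quad_def
    by (rule derivative_eq_intros g refl | simp)+
      (auto simp: algebra_simps inner_commute)
  then show ?thesis by (simp add: exp_quad_def[abs_def])
qed

lemma exp_quad_C2:
  fixes g g' g'' :: "real \<Rightarrow> real"
  assumes g: "\<And>t. (g has_real_derivative g' t) (at t)"
    and g': "\<And>t. (g' has_real_derivative g'' t) (at t)"
    and g'': "continuous_on UNIV g''"
  shows "C2_on UNIV (exp_quad \<gamma> g :: 'a::euclidean_space \<times> real \<Rightarrow> real)"
proof (rule C2_on_UNIV_intro[OF exp_quad_has_derivative[OF g]])
  fix v :: "'a \<times> real"
  have cg': "continuous_on UNIV g'"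
    using g' by (auto intro!: continuous_at_imp_continuous_on DERIV_isCont)
  note dg' = has_derivative_comp_snd[OF g']
  have "C1_on UNIV (\<lambda>p::'a \<times> real. g' (snd p) * snd v + 2 * \<gamma> * (fst p \<bullet> fst v))"
  proof (rule C1_on_UNIV_intro)
    show "((\<lambda>p. g' (snd p) * snd v + 2 * \<gamma> * (fst p \<bullet> fst v)) has_derivative
      (\<lambda>w. g'' (snd p) * snd w * snd v + 2 * \<gamma> * (fst w \<bullet> fst v))) (at p)"
      for p :: "'a \<times> real"
      by (rule derivative_eq_intros dg' refl | simp)+
    show "continuous_on UNIV
       (\<lambda>p::'a \<times> real. g'' (snd p) * snd w * snd v + 2 * \<gamma> * (fst w \<bullet> fst v))"
      for w :: "'a \<times> real"
      by (intro continuous_intros continuous_on_compose2[OF g'']) auto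
  qed
  moreover have "C1_on UNIV (exp_quad \<gamma> g :: 'a \<times> real \<Rightarrow> real)"
  proof (rule C1_on_UNIV_intro[OF exp_quad_has_derivative[OF g]])
    fix v :: "'a \<times> real"
    have "continuous_on UNIV (exp_quad \<gamma> g :: 'a \<times> real \<Rightarrow> real)"
      using exp_quad_has_derivative[OF g]
      by (auto intro!: continuous_at_imp_continuous_on has_derivative_continuous)
    then show "continuous_on UNIV (\<lambda>p::'a \<times> real.
       (g' (snd p) * snd v + 2 * \<gamma> * (fst p \<bullet> fst v)) * exp_quad \<gamma> g p)"
      by (intro continuous_intros continuous_on_compose2[OF cg']) auto
  qed
  ultimately show "C1_on UNIV (\<lambda>p::'a \<times> real.
       (g' (snd p) * snd v + 2 * \<gamma> * (fst p \<bullet> fst v)) * exp_quad \<gamma> g p)"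
    by (rule C1_on_mult)
qed

lemma dx_exp_quad:
  assumes "\<And>t. (g has_real_derivative g' t) (at t)"
  shows "dx i (exp_quad \<gamma> g) = (\<lambda>p. 2 * \<gamma> * (fst p $ i) * exp_quad \<gamma> g p)"
  unfolding dx_def
  by (rule ext) (subst dir_deriv_eq[OF exp_quad_has_derivative[OF assms]],
      simp add: inner_axis)

lemma dx_dx_exp_quad:
  assumes "\<And>t. (g has_real_derivative g' t) (at t)"
  shows "dx i (dx j (exp_quad \<gamma> g)) p =
    ((if i = j then 2 * \<gamma> else 0) + 4 * \<gamma>\<^sup>2 * (fst p $ i) * (fst p $ j)) * exp_quad \<gamma> g p"
proof -
  have "((\<lambda>p. 2 * \<gamma> * (fst p $ j) * exp_quad \<gamma> g p) has_derivative
     (\<lambda>v. 2 * \<gamma> * (fst p $ j) *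
         ((g' (snd p) * snd v + 2 * \<gamma> * (fst p \<bullet> fst v)) * exp_quad \<gamma> g p)
        + 2 * \<gamma> * (fst v $ j) * exp_quad \<gamma> g p)) (at p)"
    by (rule derivative_eq_intros exp_quad_has_derivative[OF assms]
         bounded_linear.has_derivative[OF bounded_linear_vec_nth] refl | simp)+
  from dir_deriv_eq[OF this, of "(axis i 1, 0)"]
  have "dx i (\<lambda>p. 2 * \<gamma> * (fst p $ j) * exp_quad \<gamma> g p) p =
    2 * \<gamma> * (fst p $ j) * ((2 * \<gamma> * (fst p $ i)) * exp_quad \<gamma> g p)
    + 2 * \<gamma> * (axis i 1 $ j) * exp_quad \<gamma> g p"
    unfolding dx_def by (simp add: inner_axis)
  then show ?thesis
    unfolding dx_exp_quad[OF assms]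
    by (auto simp: axis_def algebra_simps power2_eq_square)
qed

lemma parabolic_op_exp_quad:
  assumes "\<And>t. (g has_real_derivative g' t) (at t)"
  shows "parabolic_op a b c (exp_quad \<gamma> g) p =
    (4 * \<gamma>\<^sup>2 * (\<Sum>i\<in>UNIV. \<Sum>j\<in>UNIV. a i j p * (fst p $ i) * (fst p $ j))
      + 2 * \<gamma> * ((\<Sum>i\<in>UNIV. a i i p) + (\<Sum>i\<in>UNIV. b i p * (fst p $ i)))
      + c p - g' (snd p)) * exp_quad \<gamma> g p"
proof -
  have dt: "dt (exp_quad \<gamma> g) p = g' (snd p) * exp_quad \<gamma> g p"
    unfolding dt_def by (subst dir_deriv_eq[OF exp_quad_has_derivative[OF assms]]) simp
  have split: "a i j p * (((if i = j then 2 * \<gamma> else 0) + 4 * \<gamma>\<^sup>2 * (fst p $ i) * (fst p $ j)) * E) =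
    (if j = i then 2 * \<gamma> * E * a i i p else 0) +
      (4 * \<gamma>\<^sup>2 * E) * (a i j p * (fst p $ i) * (fst p $ j))" for i j E
    by (auto simp: algebra_simps)
  show ?thesis
    unfolding parabolic_op_def lin_op_def dt
    unfolding dx_dx_exp_quad[OF assms]
    unfolding dx_exp_quad[OF assms] split
    by (simp add: sum.distrib flip: sum_distrib_left)
      (simp add: algebra_simps sum_distrib_left)
qed

section \<open>Comparison with strict subsolutions\<close>

lemma lsc_on_eventually_above_continuous:
  assumes "lsc_on S u" "continuous_on S f" "x \<in> S" "f x < u x"
  shows "\<forall>\<^sub>F z in at x within S. f z < u z"
proof -
  define m where "m = (f x + u x) / 2"
  have "f x < m" "m < u x" using assms(4) by (auto simp: m_def)
  have "\<forall>\<^sub>F z in at x within S. f z < m"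
    using assms(2,3) \<open>f x < m\<close> by (auto simp: continuous_on_def intro: order_tendstoD)
  moreover have "\<forall>\<^sub>F z in at x within S. m < u z"
    using assms(1,3) \<open>m < u x\<close> by (auto simp: lsc_on_def)
  ultimately show ?thesis by eventually_elim auto
qed

text \<open>Without a minimum, each point \<open>x\<close> has a neighbourhood on which \<open>f\<close> exceeds some value
  \<open>f (y x)\<close>. Among the finitely many \<open>y x\<close> of a finite subcover one has the smallest value of \<open>f\<close>,
  but it lies itself in one of these neighbourhoods.\<close>
lemma lsc_on_attains_inf:
  fixes f :: "'a::topological_space \<Rightarrow> real"
  assumes "compact S" "S \<noteq> {}" "lsc_on S f"
  shows "\<exists>x\<in>S. \<forall>y\<in>S. f x \<le> f y"
proof (rule ccontr)
  assume "\<not> (\<exists>x\<in>S. \<forall>y\<in>S. f x \<le> f y)"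
  then have below: "\<exists>y\<in>S. f y < f x" if "x \<in> S" for x
    using that by (auto simp: not_le)
  have "\<exists>V. open V \<and> x \<in> V \<and> (\<exists>y\<in>S. \<forall>z\<in>V \<inter> S. f y < f z)" if x: "x \<in> S" for x
  proof -
    obtain y where y: "y \<in> S" "f y < f x" using below x by blast
    then have "\<forall>\<^sub>F z in at x within S. f y < f z"
      using assms(3) x by (auto simp: lsc_on_def)
    then obtain V where "open V" "x \<in> V" "\<forall>z\<in>V. z \<noteq> x \<longrightarrow> z \<in> S \<longrightarrow> f y < f z"
      unfolding eventually_at_topological by blast
    then show ?thesis using y by (metis IntE)
  qed
  then obtain V y where V: "\<And>x. x \<in> S \<Longrightarrow> open (V x)" "\<And>x. x \<in> S \<Longrightarrow> x \<in> V x"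
    and y: "\<And>x. x \<in> S \<Longrightarrow> y x \<in> S" "\<And>x z. x \<in> S \<Longrightarrow> z \<in> V x \<inter> S \<Longrightarrow> f (y x) < f z"
    by metis
  obtain C where C: "C \<subseteq> S" "finite C" "S \<subseteq> (\<Union>x\<in>C. V x)"
    using compactE_image[OF assms(1), of S V] V by (metis UN_I subsetI)
  have "C \<noteq> {}" using C(3) assms(2) by auto
  have "Min ((\<lambda>x. f (y x)) ` C) \<in> (\<lambda>x. f (y x)) ` C"
    using C(2) \<open>C \<noteq> {}\<close> by (intro Min_in) auto
  then obtain x where x: "x \<in> C" "\<And>x'. x' \<in> C \<Longrightarrow> f (y x) \<le> f (y x')"
    using C(2) by (auto simp: Min_le) (metis C(2) Min_le finite_imageI imageI)
  have "y x \<in> S" using x(1) C(1) y(1) by auto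
  then obtain x' where "x' \<in> C" "y x \<in> V x'" using C(3) by auto
  then have "f (y x') < f (y x)" using y(2) C(1) \<open>y x \<in> S\<close> by blast
  then show False using x(2)[OF \<open>x' \<in> C\<close>] by simp
qed

lemma viscosity_supersol_global_test:
  assumes super: "viscosity_supersol a b c e T u" and p: "p \<in> par_cylinder T"
    and \<phi>: "C2_on UNIV \<phi>" "\<And>q. q \<in> par_cylinder T \<Longrightarrow> \<phi> q \<le> u q" "\<phi> p = u p"
  shows "parabolic_op a b c \<phi> p \<le> e"
  unfolding parabolic_op_def
  using super[unfolded viscosity_supersol_def, THEN bspec, OF p, THEN spec, of UNIV,
      THEN spec, of \<phi>] \<phi> by auto

text \<open>The hypothesis \<open>sub\<close> says that \<open>\<psi>\<close> is a strict subsolution in a form that is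
  stable under maxima: at each point some smooth strict subsolution touches \<open>\<psi>\<close> from below.
  If \<open>u < \<psi>\<close> somewhere, then \<open>(u - \<psi>) exp (-K t)\<close> has a negative minimum \<open>m\<close>, attained off the
  parabolic boundary, so \<open>\<phi> + m exp (K t)\<close> is a test function for \<open>u\<close>. The exponential
  weight makes the zeroth-order coefficient effectively \<open>c - K \<le> 0\<close>; as \<open>m < 0\<close>, adding
  \<open>m exp (K t)\<close> does not decrease the operator, and strictness is contradicted.\<close>
lemma supersolution_ge_strict_subsolution:
  fixes u \<psi> :: "(real ^ 'n::finite) \<times> real \<Rightarrow> real"
  assumes lsc: "lsc_on (cball 0 1 \<times> {0..T}) u"
    and super: "viscosity_supersol a b c e T u"
    and c: "\<And>p. p \<in> par_cylinder T \<Longrightarrow> c p \<le> K"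
    and cont: "continuous_on (cball 0 1 \<times> {0..T}) \<psi>"
    and sub: "\<And>p. p \<in> par_cylinder T \<Longrightarrow>
      \<exists>\<phi>. C2_on UNIV \<phi> \<and> (\<forall>q. \<phi> q \<le> \<psi> q) \<and> \<phi> p = \<psi> p \<and> e < parabolic_op a b c \<phi> p"
    and bdry: "\<And>p. p \<in> par_boundary T \<Longrightarrow> \<psi> p \<le> u p"
    and p: "p \<in> cball 0 1 \<times> {0..T}"
  shows "\<psi> p \<le> u p"
proof (rule ccontr)
  assume neg: "\<not> \<psi> p \<le> u p"
  let ?S = "cball 0 1 \<times> {0..T} :: ((real ^ 'n) \<times> real) set"
  define W where "W q = (u q - \<psi> q) * exp (- K * snd q)" for q
  have W_gt: "y < W q \<longleftrightarrow> \<psi> q + y * exp (K * snd q) < u q" for y q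
    by (simp add: W_def exp_minus field_simps)
  have "lsc_on ?S W"
    unfolding lsc_on_def W_gt
    by (intro ballI allI impI lsc_on_eventually_above_continuous[OF lsc]
        continuous_intros cont) auto
  moreover have "compact ?S" by (intro compact_Times compact_cball compact_Icc)
  ultimately obtain p0 where p0: "p0 \<in> ?S" "\<And>q. q \<in> ?S \<Longrightarrow> W p0 \<le> W q"
    using lsc_on_attains_inf[of ?S W] p by (metis empty_iff)
  define m where "m = W p0"
  have "W p < 0" using neg by (simp add: W_def mult_less_0_iff)
  then have m: "m < 0" using p0(2)[OF p] by (simp add: m_def)
  have above: "\<psi> q + m * exp (K * snd q) \<le> u q" if "q \<in> ?S" for q
    using p0(2)[OF that] unfolding m_def[symmetric]
    by (simp add: W_def exp_minus field_simps)
  have at_p0: "\<psi> p0 + m * exp (K * snd p0) = u p0"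
    by (simp add: W_def m_def exp_minus field_simps)
  have "p0 \<notin> par_boundary T"
    using bdry[of p0] m at_p0 mult_neg_pos[OF m exp_gt_zero, of "K * snd p0"] by linarith
  then have cyl: "p0 \<in> par_cylinder T"
    using p0(1) by (auto simp: par_boundary_def par_cylinder_def)
  obtain \<phi> where \<phi>: "C2_on UNIV \<phi>" "\<And>q. \<phi> q \<le> \<psi> q" "\<phi> p0 = \<psi> p0" "e < parabolic_op a b c \<phi> p0"
    using sub[OF cyl] by blast
  let ?E = "exp_quad 0 (\<lambda>t. K * t) :: (real ^ 'n) \<times> real \<Rightarrow> real"
  let ?\<phi> = "\<lambda>q. \<phi> q + m * ?E q"
  have dE: "((\<lambda>t. K * t) has_real_derivative K) (at t)" for t
    by (auto intro!: derivative_eq_intros)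
  have E: "C2_on UNIV ?E"
    by (rule exp_quad_C2[OF dE, where g'' = "\<lambda>_. 0"]) auto
  have "?\<phi> q \<le> u q" if "q \<in> par_cylinder T" for q
  proof -
    have "q \<in> ?S" using that by (auto simp: par_cylinder_def)
    from above[OF this] \<phi>(2)[of q] show ?thesis by (simp add: exp_quad_def)
  qed
  moreover have "?\<phi> p0 = u p0" using \<phi>(3) at_p0 by (simp add: exp_quad_def)
  moreover have "C2_on UNIV ?\<phi>" by (intro C2_on_add C2_on_cmult \<phi>(1) E)
  ultimately have "parabolic_op a b c ?\<phi> p0 \<le> e"
    using viscosity_supersol_global_test[OF super cyl] by blast
  moreover have "parabolic_op a b c ?\<phi> p0 = parabolic_op a b c \<phi> p0 + m * ((c p0 - K) * ?E p0)"
    by (simp add: parabolic_op_add parabolic_op_cmult C2_on_cmult \<phi>(1) E parabolic_op_exp_quad[OF dE])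
  moreover have "m * ((c p0 - K) * ?E p0) \<ge> 0"
    using m c[OF cyl] by (intro mult_nonpos_nonpos) (auto simp: exp_quad_def mult_le_0_iff)
  ultimately show False using \<phi>(4) by linarith
qed

section \<open>The barrier\<close>

text \<open>The ramp must not exceed \<open>1\<close>, or else the paraboloid would leave the ball through the lateral
  boundary, and this is needed even after the peak: the touching condition in the definition of
  a viscosity supersolution also looks at times later than the test point, so the
  comparison takes place on the whole of \<open>[0, T]\<close> and not just up to the target time. Nor may it
  drop below \<open>d\<close>, which keeps the paraboloid high near the axis. The profile
  \<open>z exp (1 - z)\<close>, which vanishes at \<open>0\<close>, peaks at \<open>z = 1\<close> with
  value \<open>1\<close> and is positive in between and afterwards, serves both purposes while being smooth.\<close>
lemma ramp_with_peak:
  fixes d T1 s :: real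
  assumes d: "0 < d" "d < 1" and s: "0 < T1" "T1 \<le> s"
  obtains \<rho> \<rho>' \<rho>'' where
    "\<And>t. (\<rho> has_real_derivative \<rho>' t) (at t)"
    "\<And>t. (\<rho>' has_real_derivative \<rho>'' t) (at t)"
    "continuous_on UNIV \<rho>''"
    "\<rho> 0 = d" "\<rho> s = 1"
    "\<And>t. \<rho> t \<le> 1" "\<And>t. 0 \<le> t \<Longrightarrow> d \<le> \<rho> t" "\<And>t. 0 \<le> t \<Longrightarrow> \<rho>' t \<le> exp 1 / T1"
proof -
  define k where "k = 1 / s"
  have k: "0 < k" "k \<le> 1 / T1" "k * s = 1" using s by (auto simp: k_def field_simps)
  define \<rho> where "\<rho> t = d + (1 - d) * (k * t * exp (1 - k * t))" for t
  define \<rho>' where "\<rho>' t = (1 - d) * (k * (1 - k * t) * exp (1 - k * t))" for t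
  define \<rho>'' where "\<rho>'' t = (1 - d) * (k\<^sup>2 * (k * t - 2) * exp (1 - k * t))" for t
  show thesis
  proof (rule that)
    show "(\<rho> has_real_derivative \<rho>' t) (at t)" for t
      unfolding \<rho>_def \<rho>'_def by (auto intro!: derivative_eq_intros simp: algebra_simps)
    show "(\<rho>' has_real_derivative \<rho>'' t) (at t)" for t
      unfolding \<rho>'_def \<rho>''_def
      by (auto intro!: derivative_eq_intros simp: algebra_simps power2_eq_square)
    show "continuous_on UNIV \<rho>''" unfolding \<rho>''_def by (intro continuous_intros)
    show "\<rho> 0 = d" by (simp add: \<rho>_def)
    show "\<rho> s = 1" using k(3) by (simp add: \<rho>_def)
    show "\<rho> t \<le> 1" for t
    proof -
      have "k * t \<le> exp (k * t - 1)" using exp_ge_add_one_self[of "k * t - 1"] by simp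
      then have "k * t * exp (1 - k * t) \<le> exp (k * t - 1) * exp (1 - k * t)"
        by (intro mult_right_mono) auto
      then have "k * t * exp (1 - k * t) \<le> 1" by (simp flip: exp_add)
      moreover have "d + (1 - d) * z \<le> 1" if "z \<le> 1" for z
      proof -
        have "(1 - d) * z \<le> 1 - d" using that d by (intro mult_left_le) auto
        then show ?thesis by linarith
      qed
      ultimately show ?thesis unfolding \<rho>_def by blast
    qed
    show "d \<le> \<rho> t" if "0 \<le> t" for t
      using d k that by (simp add: \<rho>_def)
    show "\<rho>' t \<le> exp 1 / T1" if "0 \<le> t" for t
    proof -
      have "(1 - k * t) * exp (1 - k * t) \<le> 1 * exp 1"
      proof (cases "k * t \<le> 1")
        case True
        then show ?thesis using k that by (intro mult_mono) auto
      next
        case False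
        then have "(1 - k * t) * exp (1 - k * t) \<le> 0" by (intro mult_nonpos_nonneg) auto
        then show ?thesis using exp_gt_zero[of "1::real"] by linarith
      qed
      then have "k * ((1 - k * t) * exp (1 - k * t)) \<le> 1 / T1 * exp 1"
        using k s by (intro order_trans[OF mult_left_mono mult_right_mono]) auto
      then have "(1 - d) * (k * ((1 - k * t) * exp (1 - k * t))) \<le> (1 - d) * (exp 1 / T1)"
        using d by (intro mult_left_mono) auto
      also have "\<dots> \<le> 1 * (exp 1 / T1)" using d s by (intro mult_right_mono) auto
      finally show ?thesis by (simp add: \<rho>'_def mult.assoc)
    qed
  qed
qed

text \<open>For \<open>\<alpha>, \<beta> > 0\<close> this is, up to a factor, the paraboloid barrier; with \<open>\<alpha>\<close> and \<open>\<beta>\<close>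
  negated and \<open>\<rho> = 1\<close> it is the corrector. Treating both at once needs a single computation of
  derivatives. The closed form is \<open>bump_eq\<close>; the definition is written as a sum of scaled
  exponentials so that linearity of the operator applies.\<close>
definition bump :: "real \<Rightarrow> real \<Rightarrow> (real \<Rightarrow> real) \<Rightarrow> ('a::real_inner) \<times> real \<Rightarrow> real" where
  "bump \<alpha> \<beta> \<rho> p =
     exp_quad (- \<alpha>) (\<lambda>t. \<alpha> * \<rho> t - \<beta> * t) p + (- 1) * exp_quad 0 (\<lambda>t. - \<beta> * t) p"

lemma bump_eq:
  "bump \<alpha> \<beta> \<rho> p = exp (- \<beta> * snd p) * (exp (\<alpha> * (\<rho> (snd p) - fst p \<bullet> fst p)) - 1)"
  by (simp add: bump_def exp_quad_def algebra_simps flip: exp_add)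

lemma
  fixes \<rho> \<rho>' \<rho>'' :: "real \<Rightarrow> real" and p :: "(real ^ 'n::finite) \<times> real"
  assumes \<rho>: "\<And>t. (\<rho> has_real_derivative \<rho>' t) (at t)"
    and \<rho>': "\<And>t. (\<rho>' has_real_derivative \<rho>'' t) (at t)"
    and \<rho>'': "continuous_on UNIV \<rho>''"
  shows bump_C2: "C2_on UNIV (bump \<alpha> \<beta> \<rho> :: (real ^ 'n) \<times> real \<Rightarrow> real)"
    and parabolic_op_bump: "parabolic_op a b c (bump \<alpha> \<beta> \<rho>) p = exp (- \<beta> * snd p) *
      (exp (\<alpha> * (\<rho> (snd p) - fst p \<bullet> fst p)) *
        (4 * \<alpha>\<^sup>2 * (\<Sum>i\<in>UNIV. \<Sum>j\<in>UNIV. a i j p * (fst p $ i) * (fst p $ j))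
         - 2 * \<alpha> * ((\<Sum>i\<in>UNIV. a i i p) + (\<Sum>i\<in>UNIV. b i p * (fst p $ i)))
         + c p + \<beta> - \<alpha> * \<rho>' (snd p)) - (c p + \<beta>))"
proof -
  have d1: "((\<lambda>t. \<alpha> * \<rho> t - \<beta> * t) has_real_derivative \<alpha> * \<rho>' t - \<beta>) (at t)" for t
    by (auto intro!: derivative_eq_intros \<rho>)
  have d1': "((\<lambda>t. \<alpha> * \<rho>' t - \<beta>) has_real_derivative \<alpha> * \<rho>'' t) (at t)" for t
    by (auto intro!: derivative_eq_intros \<rho>')
  have d2: "((\<lambda>t. - \<beta> * t) has_real_derivative - \<beta>) (at t)" for t
    by (auto intro!: derivative_eq_intros)
  have C1: "C2_on UNIV (exp_quad (- \<alpha>) (\<lambda>t. \<alpha> * \<rho> t - \<beta> * t) :: (real ^ 'n) \<times> real \<Rightarrow> real)"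
    by (rule exp_quad_C2[OF d1 d1']) (intro continuous_intros \<rho>'')
  have C2: "C2_on UNIV (exp_quad 0 (\<lambda>t. - \<beta> * t) :: (real ^ 'n) \<times> real \<Rightarrow> real)"
    by (rule exp_quad_C2[OF d2, where g'' = "\<lambda>_. 0"]) auto
  show "C2_on UNIV (bump \<alpha> \<beta> \<rho> :: (real ^ 'n) \<times> real \<Rightarrow> real)"
    unfolding bump_def[abs_def] by (intro C2_on_add C2_on_cmult C1 C2)
  have e: "exp_quad (- \<alpha>) (\<lambda>t. \<alpha> * \<rho> t - \<beta> * t) p =
      exp (- \<beta> * snd p) * exp (\<alpha> * (\<rho> (snd p) - fst p \<bullet> fst p))"
    by (simp add: exp_quad_def algebra_simps flip: exp_add)
  have "parabolic_op a b c (bump \<alpha> \<beta> \<rho>) p = parabolic_op a b c (exp_quad (- \<alpha>) (\<lambda>t. \<alpha> * \<rho> t - \<beta> * t)) p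
     + (- 1) * parabolic_op a b c (exp_quad 0 (\<lambda>t. - \<beta> * t)) p"
    unfolding bump_def[abs_def]
    by (subst parabolic_op_add[OF C1 C2_on_cmult[OF C2]], subst parabolic_op_cmult[OF C2]) (rule refl)
  then show "parabolic_op a b c (bump \<alpha> \<beta> \<rho>) p = exp (- \<beta> * snd p) *
      (exp (\<alpha> * (\<rho> (snd p) - fst p \<bullet> fst p)) *
        (4 * \<alpha>\<^sup>2 * (\<Sum>i\<in>UNIV. \<Sum>j\<in>UNIV. a i j p * (fst p $ i) * (fst p $ j))
         - 2 * \<alpha> * ((\<Sum>i\<in>UNIV. a i i p) + (\<Sum>i\<in>UNIV. b i p * (fst p $ i)))
         + c p + \<beta> - \<alpha> * \<rho>' (snd p)) - (c p + \<beta>))"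
    unfolding parabolic_op_exp_quad[OF d1] parabolic_op_exp_quad[OF d2] e
    by (simp add: exp_quad_def algebra_simps)
qed

text \<open>The choice of \<open>\<alpha>\<close> and \<open>\<beta>\<close>, abstracted from the operator: \<open>s\<close> stands for \<open>|x|\<^sup>2\<close>, \<open>Q\<close> for
  \<open>a x x\<close>, \<open>D\<close> for trace plus drift, \<open>r\<close> for \<open>\<rho>'\<close> and \<open>w\<close> for the height of the paraboloid. The two
  conclusions are the bracket in \<open>parabolic_op_bump\<close> for the barrier and for the corrector.
  Up to a factor \<open>exp (\<alpha> w)\<close> or \<open>exp (- \<alpha> w)\<close> both follow from the estimate \<open>core\<close> below,
  in which \<open>s > \<sigma>\<close> is settled by the choice of \<open>\<alpha>\<close> and \<open>s \<le> \<sigma>\<close>, where \<open>w\<close> is at least \<open>3 \<sigma>\<close>, by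
  that of \<open>\<beta>\<close>.\<close>
lemma barrier_exponents:
  fixes \<sigma> lam Lam M R :: real
  assumes "0 < \<sigma>" "0 < lam" "0 < Lam" "0 \<le> M" "0 \<le> R"
  obtains \<alpha> \<beta> where "0 < \<alpha>" "0 < \<beta>" "Lam \<le> \<beta>"
    and "\<And>s w Q D c r. \<lbrakk>0 \<le> s; 0 < w; s \<le> \<sigma> \<Longrightarrow> 3 * \<sigma> \<le> w; lam * s \<le> Q; \<bar>D\<bar> \<le> M; \<bar>c\<bar> \<le> Lam; r \<le> R\<rbrakk>
      \<Longrightarrow> 0 < exp (\<alpha> * w) * (4 * \<alpha>\<^sup>2 * Q - 2 * \<alpha> * D + c + \<beta> - \<alpha> * r) - (c + \<beta>)"
    and "\<And>s w Q D c. \<lbrakk>0 \<le> s; 0 < w; w \<le> 1; s \<le> \<sigma> \<Longrightarrow> 3 * \<sigma> \<le> w; lam * s \<le> Q; \<bar>D\<bar> \<le> M; \<bar>c\<bar> \<le> Lam\<rbrakk>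
      \<Longrightarrow> \<alpha> * exp (- \<alpha>) \<le> exp (- \<alpha> * w) * (4 * \<alpha>\<^sup>2 * Q + 2 * \<alpha> * D + c - \<beta>) - (c - \<beta>)"
proof -
  (* B dominates the lower-order terms 2 * |D| + r with room 1 to spare; \<alpha> solves
     4 * \<alpha>^2 * lam * \<sigma> = \<alpha> * B, and \<beta> solves (\<beta> - Lam) * (1 - exp (-3 * \<alpha> * \<sigma>)) = \<alpha> * B. *)
  define B where "B = 2 * M + R + 1"
  define \<alpha> where "\<alpha> = B / (4 * lam * \<sigma>)"
  define \<beta> where "\<beta> = Lam + \<alpha> * B / (1 - exp (- \<alpha> * (3 * \<sigma>)))"
  have B: "0 < B" using assms by (simp add: B_def)
  have \<alpha>: "0 < \<alpha>" using assms B by (simp add: \<alpha>_def)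
  have gap: "0 < 1 - exp (- \<alpha> * (3 * \<sigma>))" using \<alpha> assms by simp
  have \<beta>: "0 < \<alpha> * B / (1 - exp (- \<alpha> * (3 * \<sigma>)))" using \<alpha> B gap by simp
  have core: "\<alpha> \<le> 4 * \<alpha>\<^sup>2 * Q - 2 * \<alpha> * D - \<alpha> * r + y * (1 - exp (- \<alpha> * w))"
    if h: "0 \<le> s" "0 < w" "s \<le> \<sigma> \<Longrightarrow> 3 * \<sigma> \<le> w" "lam * s \<le> Q" "\<bar>D\<bar> \<le> M" "r \<le> R" "\<beta> - Lam \<le> y"
    for s w Q D r y
  proof -
    have lower: "\<alpha> - \<alpha> * B \<le> - 2 * \<alpha> * D - \<alpha> * r"
    proof -
      have "2 * D + r \<le> B - 1" using h(5,6) by (simp add: B_def)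
      from mult_left_mono[OF this, of \<alpha>] \<alpha> show ?thesis by (simp add: algebra_simps)
    qed
    have Q: "0 \<le> Q" using h(1,4) assms by (meson mult_nonneg_nonneg less_imp_le order_trans)
    have y: "0 < y" using h(7) \<beta> by (simp add: \<beta>_def)
    show ?thesis
    proof (cases "s \<le> \<sigma>")
      case True
      have "\<alpha> * B = (\<beta> - Lam) * (1 - exp (- \<alpha> * (3 * \<sigma>)))"
        using gap assms(1) by (simp add: \<beta>_def)
      also have "\<dots> \<le> y * (1 - exp (- \<alpha> * w))"
        using h(3)[OF True] h(7) gap \<alpha> y by (intro mult_mono) auto
      finally have "\<alpha> * B \<le> y * (1 - exp (- \<alpha> * w))" .
      moreover have "0 \<le> 4 * \<alpha>\<^sup>2 * Q" using Q by simp
      ultimately show ?thesis using lower by linarith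
    next
      case False
      have "lam * \<sigma> \<le> Q"
        using h(4) False assms mult_left_mono[of \<sigma> s lam] by linarith
      then have "4 * \<alpha>\<^sup>2 * (lam * \<sigma>) \<le> 4 * \<alpha>\<^sup>2 * Q" by (intro mult_left_mono) auto
      moreover have "4 * \<alpha>\<^sup>2 * (lam * \<sigma>) = \<alpha> * B"
        using assms by (simp add: \<alpha>_def power2_eq_square)
      moreover have "0 \<le> y * (1 - exp (- \<alpha> * w))" using y \<alpha> h(2) by simp
      ultimately show ?thesis using lower by linarith
    qed
  qed
  show thesis
  proof (rule that)
    show "0 < \<alpha>" by fact
    show "0 < \<beta>" "Lam \<le> \<beta>" using \<beta> assms by (auto simp: \<beta>_def)
    fix s w Q D c r :: real
    assume h: "0 \<le> s" "0 < w" "s \<le> \<sigma> \<Longrightarrow> 3 * \<sigma> \<le> w" "lam * s \<le> Q" "\<bar>D\<bar> \<le> M" "\<bar>c\<bar> \<le> Lam"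
    { assume "r \<le> R"
      then have "\<alpha> \<le> 4 * \<alpha>\<^sup>2 * Q - 2 * \<alpha> * D - \<alpha> * r + (\<beta> + c) * (1 - exp (- \<alpha> * w))"
        using h by (intro core[of s]) auto
      then have "0 < exp (\<alpha> * w) *
          (4 * \<alpha>\<^sup>2 * Q - 2 * \<alpha> * D - \<alpha> * r + (\<beta> + c) * (1 - exp (- \<alpha> * w)))"
        using \<alpha> by simp
      then show "0 < exp (\<alpha> * w) * (4 * \<alpha>\<^sup>2 * Q - 2 * \<alpha> * D + c + \<beta> - \<alpha> * r) - (c + \<beta>)"
        by (simp add: algebra_simps exp_minus) }
    assume "w \<le> 1"
    have "\<alpha> \<le> 4 * \<alpha>\<^sup>2 * Q - 2 * \<alpha> * (- D) - \<alpha> * 0 + (\<beta> - c) * (1 - exp (- \<alpha> * w))"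
      using h assms(5) by (intro core[of s]) auto
    also have "\<dots> \<le> 4 * \<alpha>\<^sup>2 * Q + 2 * \<alpha> * D + (\<beta> - c) * (exp (\<alpha> * w) - 1)"
    proof -
      have "1 - exp (- \<alpha> * w) \<le> \<alpha> * w" "\<alpha> * w \<le> exp (\<alpha> * w) - 1"
        using exp_ge_add_one_self[of "- \<alpha> * w"] exp_ge_add_one_self[of "\<alpha> * w"] by linarith+
      then have "(\<beta> - c) * (1 - exp (- \<alpha> * w)) \<le> (\<beta> - c) * (exp (\<alpha> * w) - 1)"
        using h(6) \<beta> by (intro mult_left_mono) (auto simp: \<beta>_def)
      then show ?thesis by simp
    qed
    finally have "exp (- \<alpha> * w) * \<alpha> \<le> exp (- \<alpha> * w) *
        (4 * \<alpha>\<^sup>2 * Q + 2 * \<alpha> * D + (\<beta> - c) * (exp (\<alpha> * w) - 1))"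
      by (intro mult_left_mono) auto
    also have "\<dots> = exp (- \<alpha> * w) * (4 * \<alpha>\<^sup>2 * Q + 2 * \<alpha> * D + c - \<beta>) - (c - \<beta>)"
      by (simp add: algebra_simps exp_minus)
    finally have "exp (- \<alpha> * w) * \<alpha> \<le> \<dots>" .
    moreover have "\<alpha> * exp (- \<alpha>) \<le> exp (- \<alpha> * w) * \<alpha>"
      using \<alpha> \<open>w \<le> 1\<close> by simp
    ultimately show "\<alpha> * exp (- \<alpha>) \<le>
        exp (- \<alpha> * w) * (4 * \<alpha>\<^sup>2 * Q + 2 * \<alpha> * D + c - \<beta>) - (c - \<beta>)"
      by linarith
  qed
qed

lemma drift_trace_bound:
  fixes A :: "'n::finite \<Rightarrow> 'n \<Rightarrow> real" and B :: "'n \<Rightarrow> real" and x :: "real ^ 'n"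
  assumes "\<And>i j. \<bar>A i j\<bar> \<le> Lam" "\<And>i. \<bar>B i\<bar> \<le> Lam" "norm x \<le> 1"
  shows "\<bar>(\<Sum>i\<in>UNIV. A i i) + (\<Sum>i\<in>UNIV. B i * (x $ i))\<bar> \<le> 2 * real CARD('n) * Lam"
proof -
  have "\<bar>\<Sum>i\<in>UNIV. A i i\<bar> \<le> real CARD('n) * Lam"
    by (rule order_trans[OF sum_abs sum_bounded_above]) (simp add: assms)
  moreover have "\<bar>B i * (x $ i)\<bar> \<le> Lam" for i
  proof -
    have "\<bar>x $ i\<bar> \<le> 1" using component_le_norm_cart[of x i] assms(3) by linarith
    then have "\<bar>B i\<bar> * \<bar>x $ i\<bar> \<le> Lam * 1"
      using assms(2)[of i] by (intro mult_mono) auto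
    then show ?thesis by (simp add: abs_mult)
  qed
  then have "\<bar>\<Sum>i\<in>UNIV. B i * (x $ i)\<bar> \<le> real CARD('n) * Lam"
    by (intro order_trans[OF sum_abs sum_bounded_above])
  ultimately show ?thesis by linarith
qed

theorem theorem5p1:
  fixes T1 T \<delta> lam Lam :: real
  assumes "0 < T1" "T1 < T" "0 < \<delta>" "\<delta> < 1" "0 < lam" "0 < Lam"
  shows "\<exists>\<epsilon>>0. \<exists>\<mu>>0.
    \<forall>(a :: 'n::finite \<Rightarrow> 'n \<Rightarrow> (real ^ 'n) \<times> real \<Rightarrow> real)
     (b :: 'n \<Rightarrow> (real ^ 'n) \<times> real \<Rightarrow> real)
     (c :: (real ^ 'n) \<times> real \<Rightarrow> real)
     (u :: (real ^ 'n) \<times> real \<Rightarrow> real).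
      (\<forall>i j. a i j \<in> borel_measurable (lebesgue_on (par_cylinder T))) \<and>
      (\<forall>i. b i \<in> borel_measurable (lebesgue_on (par_cylinder T))) \<and>
      c \<in> borel_measurable (lebesgue_on (par_cylinder T)) \<and>
      (\<forall>p \<in> par_cylinder T. \<forall>i j. \<bar>a i j p\<bar> + \<bar>b i p\<bar> + \<bar>c p\<bar> \<le> Lam) \<and>
      (\<forall>p \<in> par_cylinder T. \<forall>\<xi> :: real ^ 'n.
         (\<Sum>i\<in>UNIV. \<Sum>j\<in>UNIV. a i j p * (\<xi> $ i) * (\<xi> $ j)) \<ge> lam * (norm \<xi>)\<^sup>2) \<and>
      lsc_on (cball 0 1 \<times> {0..T}) u \<and>
      viscosity_supersol a b c \<epsilon> T u \<and>
      (\<forall>x. norm x \<le> \<delta> \<longrightarrow> u (x, 0) \<ge> 1) \<and>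
      (\<forall>p \<in> par_boundary T. u p \<ge> 0)
      \<longrightarrow> (\<forall>x \<in> ball 0 1. \<forall>t \<in> {T1..T}. u (x, t) \<ge> \<mu> * (1 - norm x))"
proof -
  (* With this \<sigma>, |x|^2 \<le> \<sigma> implies \<rho> - |x|^2 \<ge> 3 * \<sigma>, since \<rho> \<ge> \<delta>^2. *)
  define \<sigma> where "\<sigma> = \<delta>\<^sup>2 / 4"
  have \<delta>2: "0 < \<delta>\<^sup>2" "\<delta>\<^sup>2 < 1" using assms by (auto simp: power_less_one_iff)
  then have \<sigma>: "0 < \<sigma>" "\<sigma> < 1 / 4" by (auto simp: \<sigma>_def)
  define M where "M = 2 * real CARD('n) * Lam"
  define R where "R = exp 1 / T1"
  have MR: "0 \<le> M" "0 \<le> R" using assms by (auto simp: M_def R_def)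
  obtain \<alpha> \<beta> where \<alpha>: "0 < \<alpha>" and \<beta>: "0 < \<beta>" "Lam \<le> \<beta>"
    and pos: "\<And>s w Q D c r. \<lbrakk>0 \<le> s; 0 < w; s \<le> \<sigma> \<Longrightarrow> 3 * \<sigma> \<le> w; lam * s \<le> Q;
        \<bar>D\<bar> \<le> M; \<bar>c\<bar> \<le> Lam; r \<le> R\<rbrakk>
      \<Longrightarrow> 0 < exp (\<alpha> * w) * (4 * \<alpha>\<^sup>2 * Q - 2 * \<alpha> * D + c + \<beta> - \<alpha> * r) - (c + \<beta>)"
    and neg: "\<And>s w Q D c. \<lbrakk>0 \<le> s; 0 < w; w \<le> 1; s \<le> \<sigma> \<Longrightarrow> 3 * \<sigma> \<le> w; lam * s \<le> Q;
        \<bar>D\<bar> \<le> M; \<bar>c\<bar> \<le> Lam\<rbrakk>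
      \<Longrightarrow> \<alpha> * exp (- \<alpha>) \<le> exp (- \<alpha> * w) * (4 * \<alpha>\<^sup>2 * Q + 2 * \<alpha> * D + c - \<beta>) - (c - \<beta>)"
    using barrier_exponents[OF \<sigma>(1) assms(5,6) MR] by blast
  (* At time s the barrier is at least exp (-\<alpha> - \<beta> * T) * \<alpha> * w and the corrector costs at most
     \<eta> * exp (\<beta> * T) * \<alpha> * w; this \<eta> makes the cost one half of the gain. *)
  define \<eta> where "\<eta> = exp (- \<alpha> - 2 * \<beta> * T) / 2"
  define \<epsilon> where "\<epsilon> = \<eta> * (\<alpha> * exp (- \<alpha>)) / 2"
  define \<mu> where "\<mu> = \<alpha> * exp (- \<alpha> - \<beta> * T) / 2"
  have \<eta>: "0 < \<eta>" by (simp add: \<eta>_def)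
  have \<epsilon>: "0 < \<epsilon>" "\<epsilon> < \<eta> * (\<alpha> * exp (- \<alpha>))" using \<eta> \<alpha> by (simp_all add: \<epsilon>_def)
  have \<mu>: "0 < \<mu>" using \<alpha> by (simp add: \<mu>_def)
  have main: "\<mu> * (1 - norm x) \<le> u (x, s)"
    if bound: "\<And>p i j. p \<in> par_cylinder T \<Longrightarrow> \<bar>a i j p\<bar> + \<bar>b i p\<bar> + \<bar>c p\<bar> \<le> Lam"
      and ell: "\<And>p \<xi>. p \<in> par_cylinder T \<Longrightarrow>
         lam * (norm \<xi>)\<^sup>2 \<le> (\<Sum>i\<in>UNIV. \<Sum>j\<in>UNIV. a i j p * (\<xi> $ i) * (\<xi> $ j))"
      and lsc: "lsc_on (cball 0 1 \<times> {0..T}) u"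
      and super: "viscosity_supersol a b c \<epsilon> T u"
      and init: "\<And>x. norm x \<le> \<delta> \<Longrightarrow> 1 \<le> u (x, 0)"
      and nonneg: "\<And>p. p \<in> par_boundary T \<Longrightarrow> 0 \<le> u p"
      and x: "norm x < 1" and s: "T1 \<le> s" "s \<le> T"
    for a :: "'n \<Rightarrow> 'n \<Rightarrow> (real ^ 'n) \<times> real \<Rightarrow> real"
      and b :: "'n \<Rightarrow> (real ^ 'n) \<times> real \<Rightarrow> real"
      and c u :: "(real ^ 'n) \<times> real \<Rightarrow> real" and x :: "real ^ 'n" and s
  proof -
    obtain \<rho> \<rho>' \<rho>'' where
      d\<rho>: "\<And>t. (\<rho> has_real_derivative \<rho>' t) (at t)"
        "\<And>t. (\<rho>' has_real_derivative \<rho>'' t) (at t)" "continuous_on UNIV \<rho>''"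
      and \<rho>: "\<rho> 0 = \<delta>\<^sup>2" "\<rho> s = 1" "\<And>t. \<rho> t \<le> 1" "\<And>t. 0 \<le> t \<Longrightarrow> \<delta>\<^sup>2 \<le> \<rho> t"
        "\<And>t. 0 \<le> t \<Longrightarrow> \<rho>' t \<le> R"
      using ramp_with_peak[OF \<delta>2 assms(1) s(1)] unfolding R_def by metis
    have d1: "((\<lambda>t. 1) has_real_derivative 0) (at t)"
      "((\<lambda>t. 0) has_real_derivative 0) (at t)" "continuous_on UNIV (\<lambda>t::real. 0::real)" for t :: real
      by auto
    define P :: "(real ^ 'n) \<times> real \<Rightarrow> real" where "P q = exp (- \<alpha>) * bump \<alpha> \<beta> \<rho> q" for q
    define N :: "(real ^ 'n) \<times> real \<Rightarrow> real"
      where "N q = \<eta> * bump (- \<alpha>) (- \<beta>) (\<lambda>t. 1) q" for q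
    have C2: "C2_on UNIV P" "C2_on UNIV N"
      unfolding P_def[abs_def] N_def[abs_def]
      by (intro C2_on_cmult bump_C2[OF d\<rho>] bump_C2[OF d1])+
    have P_pos: "0 < P q \<longleftrightarrow> fst q \<bullet> fst q < \<rho> (snd q)" for q
      using \<alpha> by (simp add: P_def bump_eq zero_less_mult_iff)
    (* P is a subsolution where it is active, and N is strict everywhere. *)
    have ops: "0 < P q \<Longrightarrow> 0 < parabolic_op a b c P q" "\<epsilon> < parabolic_op a b c N q"
      if q: "q \<in> par_cylinder T" for q
    proof -
      obtain y t where [simp]: "q = (y, t)" by (cases q)
      have y: "norm y < 1" and t: "0 < t" using q by (auto simp: par_cylinder_def)
      define S where "S = y \<bullet> y"
      have S: "0 \<le> S" "S < 1"
        using y by (auto simp: S_def power_less_one_iff simp flip: power2_norm_eq_inner)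
      define Q where "Q = (\<Sum>i\<in>UNIV. \<Sum>j\<in>UNIV. a i j q * (y $ i) * (y $ j))"
      define D where "D = (\<Sum>i\<in>UNIV. a i i q) + (\<Sum>i\<in>UNIV. b i q * (y $ i))"
      have Q: "lam * S \<le> Q"
        using ell[OF q, of y] by (simp add: Q_def S_def power2_norm_eq_inner)
      have coeff: "\<bar>a i j q\<bar> \<le> Lam" "\<bar>b i q\<bar> \<le> Lam" "\<bar>c q\<bar> \<le> Lam" for i j
        using bound[OF q, of i j] by linarith+
      have D: "\<bar>D\<bar> \<le> M"
        unfolding D_def M_def using coeff y by (intro drift_trace_bound) auto
      show "0 < parabolic_op a b c P q" if "0 < P q"
      proof -
        have "0 < \<rho> t - S" using that P_pos[of q] by (simp add: S_def)
        moreover have "3 * \<sigma> \<le> \<rho> t - S" if "S \<le> \<sigma>"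
          using that \<rho>(4)[of t] t by (simp add: \<sigma>_def)
        ultimately have "0 < exp (\<alpha> * (\<rho> t - S)) *
            (4 * \<alpha>\<^sup>2 * Q - 2 * \<alpha> * D + c q + \<beta> - \<alpha> * \<rho>' t) - (c q + \<beta>)"
          using \<rho>(5)[of t] t by (intro pos[OF S(1) _ _ Q D coeff(3)]) auto
        then show ?thesis
          unfolding P_def[abs_def] parabolic_op_cmult[OF bump_C2[OF d\<rho>]] parabolic_op_bump[OF d\<rho>]
          by (simp add: Q_def D_def S_def)
      qed
      have "\<alpha> * exp (- \<alpha>) \<le> exp (- \<alpha> * (1 - S)) *
          (4 * \<alpha>\<^sup>2 * Q + 2 * \<alpha> * D + c q - \<beta>) - (c q - \<beta>)" (is "_ \<le> ?B")
        using S \<sigma> by (intro neg[OF S(1) _ _ _ Q D coeff(3)]) auto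
      moreover have "1 * (\<alpha> * exp (- \<alpha>)) \<le> exp (\<beta> * t) * ?B"
        using calculation \<beta> t \<alpha> by (intro mult_mono) auto
      then have "\<eta> * (\<alpha> * exp (- \<alpha>)) \<le> \<eta> * (exp (\<beta> * t) * ?B)"
        using \<eta> by (intro mult_left_mono) auto
      moreover have "parabolic_op a b c N q = \<eta> * (exp (\<beta> * t) * ?B)"
        unfolding N_def[abs_def] parabolic_op_cmult[OF bump_C2[OF d1]] parabolic_op_bump[OF d1]
        by (simp add: Q_def D_def S_def)
      ultimately show "\<epsilon> < parabolic_op a b c N q" using \<epsilon>(2) by linarith
    qed
    have N_nonpos: "N q \<le> 0" if "fst q \<in> cball 0 1" for q
    proof -
      have "fst q \<bullet> fst q \<le> 1"
        using that by (simp add: power_le_one_iff flip: power2_norm_eq_inner)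
      then have "\<alpha> * (1 - fst q \<bullet> fst q) \<ge> 0" using \<alpha> by simp
      then show ?thesis using \<eta> by (simp add: N_def bump_eq mult_le_0_iff zero_le_mult_iff)
    qed
    have "max (P (x, s)) 0 + N (x, s) \<le> u (x, s)"
    proof (rule supersolution_ge_strict_subsolution[OF lsc super])
      show "c q \<le> Lam" if "q \<in> par_cylinder T" for q
        using bound[OF that, of undefined undefined] by linarith
      show "continuous_on (cball 0 1 \<times> {0..T}) (\<lambda>q. max (P q) 0 + N q)"
        using C2[THEN C2_on_imp_C1_on, THEN C1_on_continuous]
        by (intro continuous_intros) (auto intro: continuous_on_subset)
      show "\<exists>\<phi>. C2_on UNIV \<phi> \<and> (\<forall>q'. \<phi> q' \<le> max (P q') 0 + N q') \<and>
          \<phi> q = max (P q) 0 + N q \<and> \<epsilon> < parabolic_op a b c \<phi> q"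
        if q: "q \<in> par_cylinder T" for q
      (* The active branch of the maximum is smooth and touches it from below. *)
      proof (cases "0 < P q")
        case True
        then show ?thesis
          using ops[OF q] C2
          by (intro exI[of _ "\<lambda>q. P q + N q"]) (auto simp: parabolic_op_add C2_on_add)
      next
        case False
        then show ?thesis using ops(2)[OF q] C2 by (intro exI[of _ N]) auto
      qed
      show "max (P q) 0 + N q \<le> u q" if q: "q \<in> par_boundary T" for q
      proof -
        have "N q \<le> 0" using q by (intro N_nonpos) (auto simp: par_boundary_def)
        (* On the parabolic boundary P is positive only inside the initial disc of radius \<delta>. *)
        moreover have "max (P q) 0 \<le> u q"
        proof (cases "0 < P q")
          case True
          obtain y t where [simp]: "q = (y, t)" by (cases q)
          have less: "(norm y)\<^sup>2 < \<rho> t" using True P_pos by (simp add: power2_norm_eq_inner)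
          then have "norm y \<noteq> 1" using \<rho>(3)[of t] by auto
          then have [simp]: "t = 0" using q by (auto simp: par_boundary_def)
          have "norm y < \<delta>" using less \<rho>(1) assms(3) by (auto intro: power_less_imp_less_base)
          then have "1 \<le> u q" using init[of y] by simp
          moreover have "P q \<le> 1"
          proof -
            have "\<rho> 0 - y \<bullet> y \<le> 1" using \<delta>2 \<rho>(1) inner_ge_zero[of y] by linarith
            then have "\<alpha> * (\<rho> 0 - y \<bullet> y) \<le> \<alpha> * 1"
              using \<alpha> by (intro mult_left_mono) auto
            then have "exp (\<alpha> * (\<rho> 0 - y \<bullet> y)) \<le> exp \<alpha>" by simp
            then have "exp (- \<alpha>) * (exp (\<alpha> * (\<rho> 0 - y \<bullet> y)) - 1) \<le> exp (- \<alpha>) * exp \<alpha>"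
              by (intro mult_left_mono) (linarith, simp)
            then show ?thesis by (simp add: P_def bump_eq flip: exp_add)
          qed
          ultimately show ?thesis by simp
        next
          case False
          then show ?thesis using nonneg[OF q] by simp
        qed
        ultimately show ?thesis by linarith
      qed
      show "(x, s) \<in> cball 0 1 \<times> {0..T}" using x s assms(1) by auto
    qed
    moreover have "\<mu> * (1 - norm x) \<le> P (x, s) + N (x, s)"
    proof -
      define w where "w = 1 - x \<bullet> x"
      have w: "1 - norm x \<le> w"
        using x power_decreasing[of 1 2 "norm x"] by (simp add: w_def flip: power2_norm_eq_inner)
      then have "0 \<le> w" using x by linarith
      have "exp (- \<alpha> - \<beta> * T) * (\<alpha> * w) \<le> exp (- \<alpha> - \<beta> * s) * (exp (\<alpha> * w) - 1)"
      proof (intro mult_mono)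
        show "\<alpha> * w \<le> exp (\<alpha> * w) - 1" using exp_ge_add_one_self[of "\<alpha> * w"] by linarith
      qed (use \<open>0 \<le> w\<close> \<alpha> \<beta> s in auto)
      then have 1: "exp (- \<alpha> - \<beta> * T) * (\<alpha> * w) \<le> P (x, s)"
        using \<rho>(2) by (simp add: P_def bump_eq w_def exp_diff exp_minus field_simps)
      have "\<eta> * exp (\<beta> * s) \<le> \<eta> * exp (\<beta> * T)" using \<eta> \<beta> s by simp
      also have "\<dots> = exp (- \<alpha> - \<beta> * T) / 2" by (simp add: \<eta>_def flip: exp_add)
      finally have "\<eta> * exp (\<beta> * s) * (1 - exp (- \<alpha> * w)) \<le> exp (- \<alpha> - \<beta> * T) / 2 * (\<alpha> * w)"
        using exp_ge_add_one_self[of "- \<alpha> * w"] \<open>0 \<le> w\<close> \<alpha> by (intro mult_mono) auto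
      moreover have "N (x, s) = - (\<eta> * exp (\<beta> * s) * (1 - exp (- \<alpha> * w)))"
        by (simp add: N_def bump_eq w_def algebra_simps)
      ultimately have 2: "- (exp (- \<alpha> - \<beta> * T) / 2 * (\<alpha> * w)) \<le> N (x, s)" by linarith
      have "\<mu> * (1 - norm x) \<le> \<mu> * w" using w \<mu> by (intro mult_left_mono) auto
      also have "\<dots> = exp (- \<alpha> - \<beta> * T) * (\<alpha> * w) - exp (- \<alpha> - \<beta> * T) / 2 * (\<alpha> * w)"
        by (simp add: \<mu>_def)
      finally show ?thesis using 1 2 by linarith
    qed
    ultimately show ?thesis by linarith
  qed
  show ?thesis
    by (rule exI[of _ \<epsilon>], rule conjI[OF \<epsilon>(1)], rule exI[of _ \<mu>], rule conjI[OF \<mu>],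
        intro allI impI ballI, elim conjE, rule main) auto
qed

end
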